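(* Let $m,n$ be positive integers. For a rational Dyck path $p$ of type $(m,n)$, let $a(p)$ denote the number of vertices of $p$, other than the origin $(0,0)$, that lie on the line $ny-mx=0$. Then \[ \sum_{p} \frac{\gcd(m,n)}{a(p)} \;=\; \frac{\gcd(m,n)}{m+n}\binom{m+n}{n}, \] where the sum runs over all rational Dyck paths $p$ of type $(m,n)$.
   Context: A rational Dyck path of type $(m,n)$ (on an $m\times n$ grid with $m$ rows and $n$ columns) is a lattice path from $(0,0)$ to $(n,m)$ consisting of $m$ unit up steps $(0,1)$ and $n$ unit right steps $(1,0)$ that never goes strictly below the line $ny-mx=0$ (i.e. every vertex $(x,y)$ satisfies $ny-mx\ge 0$). Vertices of the path on the line $ny-mx=0$ are called anchors; $a(p)\ge 1$ since the endpoint $(n,m)$ is an anchor. The quantity $\gcd(m,n)/a(p)$ is called the anchored weight of $p$, and $C^{gen}_{m,n}=\frac{\gcd(m,n)}{m+n}\binom{m+n}{n}$. *)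

theory Defs
  imports Complex_Main
begin

datatype step = Up | Right

(* A lattice path starting at the origin is given by its list of steps; vertex p k is the
   point (x, y) reached after the first k steps, for k <= length p. *)

definition vertex :: "step list \<Rightarrow> nat \<Rightarrow> int \<times> int" where
  "vertex p k = (int (count_list (take k p) Right), int (count_list (take k p) Up))"

definition vertices :: "step list \<Rightarrow> (int \<times> int) set" where
  "vertices p = vertex p ` {0..length p}"

(* m rows and n columns: m up steps and n right steps, so the path ends at (n, m). *)

definition rational_dyck_paths :: "nat \<Rightarrow> nat \<Rightarrow> step list set" where
  "rational_dyck_paths m n =
     {p. count_list p Up = m \<and> count_list p Right = n \<and>
         (\<forall>(x, y) \<in> vertices p. int n * y - int m * x \<ge> 0)}"

definition anchors :: "nat \<Rightarrow> nat \<Rightarrow> step list \<Rightarrow> (int \<times> int) set" where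
  "anchors m n p =
     {(x, y). (x, y) \<in> vertices p \<and> (x, y) \<noteq> (0, 0) \<and> int n * y - int m * x = 0}"

lemma length_step_list: "length p = count_list p Up + count_list p Right"
proof (induction p)
  case (Cons s p)
  then show ?case by (cases s) auto
qed simp

lemma vertex_length:
  assumes "p \<in> rational_dyck_paths m n"
  shows "vertex p (length p) = (int n, int m)"
  using assms by (simp add: rational_dyck_paths_def vertex_def)

lemma finite_rational_dyck_paths: "finite (rational_dyck_paths m n)"
proof (rule finite_subset)
  have "UNIV = {Up, Right}"
    using step.exhaust by auto
  then have "finite (UNIV :: step set)"
    by (metis finite.emptyI finite.insertI)
  then show "finite {p :: step list. set p \<subseteq> UNIV \<and> length p = m + n}"
    by (rule finite_lists_length_eq)
  show "rational_dyck_paths m n \<subseteq> {p. set p \<subseteq> UNIV \<and> length p = m + n}"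
    by (auto simp: rational_dyck_paths_def length_step_list)
qed

lemma finite_anchors: "finite (anchors m n p)"
  by (rule finite_subset[of _ "vertices p"]) (auto simp: anchors_def vertices_def)

lemma card_anchors_pos:
  assumes "m > 0" "p \<in> rational_dyck_paths m n"
  shows "card (anchors m n p) \<ge> 1"
proof -
  have "(int n, int m) \<in> vertices p"
    using vertex_length[OF assms(2)] by (force simp: vertices_def)
  then have "(int n, int m) \<in> anchors m n p"
    using assms(1) by (simp add: anchors_def)
  then have "card (anchors m n p) > 0"
    using finite_anchors card_gt_0_iff by blast
  then show ?thesis by simp
qed

end

theory Submission
  imports Defs
begin

text \<open>
  Call a word with m up steps and n right steps balanced. A cyclic shift of a balanced word
  is a Dyck path exactly if it starts at a vertex where the height n y - m x is minimal. Every
  balanced word has such a shift, and for a Dyck path p these are the shifts starting at its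
  anchors (the origin being identified with the endpoint), so a(p) is the number of shifts that
  are Dyck paths. Distributing the weight 1 of each balanced word equally over its good shifts
  gives each Dyck path weight (m + n) / a(p), and there are binomial(m + n, n) balanced words.
\<close>

definition balanced_words :: "nat \<Rightarrow> nat \<Rightarrow> step list set" where
  "balanced_words m n = {p. count_list p Up = m \<and> count_list p Right = n}"

text \<open>Defined on words rather than points so that it is additive under concatenation; the
  vertex reached after k steps has height \<open>height m n (take k p)\<close>.\<close>

definition height :: "nat \<Rightarrow> nat \<Rightarrow> step list \<Rightarrow> int" where
  "height m n p = int n * int (count_list p Up) - int m * int (count_list p Right)"

text \<open>Shifts are recorded by starting index, so a periodic word counts equal shifts with
  multiplicity.\<close>

definition dyck_shifts :: "nat \<Rightarrow> nat \<Rightarrow> step list \<Rightarrow> nat set" where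
  "dyck_shifts m n p = {k. k < length p \<and> rotate k p \<in> rational_dyck_paths m n}"

lemma length_balanced_words: "p \<in> balanced_words m n \<Longrightarrow> length p = m + n"
  by (simp add: balanced_words_def length_step_list)

lemma balanced_words_0_left: "balanced_words 0 n = {replicate n Right}"
proof -
  have "p = replicate n Right" if "p \<in> balanced_words 0 n" for p
  proof (rule replicate_eqI)
    show "length p = n" using length_balanced_words[OF that] by simp
    have "Up \<notin> set p"
      using that by (simp add: balanced_words_def count_list_0_iff)
    then show "s = Right" if "s \<in> set p" for s
      using that by (cases s) auto
  qed
  moreover have "count_list (replicate n Right) Up = 0" "count_list (replicate n Right) Right = n"
    by (induction n) auto
  ultimately show ?thesis by (auto simp: balanced_words_def)
qed

lemma balanced_words_0_right: "balanced_words m 0 = {replicate m Up}"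
proof -
  have "p = replicate m Up" if "p \<in> balanced_words m 0" for p
  proof (rule replicate_eqI)
    show "length p = m" using length_balanced_words[OF that] by simp
    have "Right \<notin> set p"
      using that by (simp add: balanced_words_def count_list_0_iff)
    then show "s = Up" if "s \<in> set p" for s
      using that by (cases s) auto
  qed
  moreover have "count_list (replicate m Up) Up = m" "count_list (replicate m Up) Right = 0"
    by (induction m) auto
  ultimately show ?thesis by (auto simp: balanced_words_def)
qed

lemma balanced_words_Suc_Suc:
  "balanced_words (Suc m) (Suc n) =
     Cons Up ` balanced_words m (Suc n) \<union> Cons Right ` balanced_words (Suc m) n"
proof -
  have "p \<in> balanced_words (Suc m) (Suc n) \<longleftrightarrow>
      p \<in> Cons Up ` balanced_words m (Suc n) \<union> Cons Right ` balanced_words (Suc m) n" for p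
  proof (cases p)
    case (Cons s q)
    then show ?thesis by (cases s) (auto simp: balanced_words_def)
  qed (auto simp: balanced_words_def)
  then show ?thesis by blast
qed

text \<open>Pascal's rule, from splitting off the first step. Finiteness is part of the induction
  because the cardinality of the disjoint union relies on it.\<close>

lemma card_balanced_words_aux:
  "finite (balanced_words m n) \<and> card (balanced_words m n) = (m + n) choose n"
proof (induction "m + n" arbitrary: m n)
  case 0
  then show ?case by (simp add: balanced_words_0_left)
next
  case (Suc l)
  show ?case
  proof (cases "m = 0 \<or> n = 0")
    case True
    then show ?thesis by (auto simp: balanced_words_0_left balanced_words_0_right)
  next
    case False
    then obtain m' n' where mn: "m = Suc m'" "n = Suc n'"
      by (meson not0_implies_Suc)
    note IH = Suc.hyps(1)[of m' n] Suc.hyps(1)[of m n']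
    have "card (balanced_words m n) = card (balanced_words m' n) + card (balanced_words m n')"
      unfolding mn balanced_words_Suc_Suc using IH Suc.hyps(2) mn
      by (subst card_Un_disjoint) (auto simp: card_image)
    then show ?thesis
      using IH Suc.hyps(2) by (simp add: mn balanced_words_Suc_Suc)
  qed
qed

lemma finite_balanced_words: "finite (balanced_words m n)"
  and card_balanced_words: "card (balanced_words m n) = (m + n) choose n"
  using card_balanced_words_aux by simp_all

lemma height_append: "height m n (p @ q) = height m n p + height m n q"
  by (simp add: height_def algebra_simps)

lemma height_Nil [simp]: "height m n [] = 0"
  by (simp add: height_def)

lemma height_balanced_word: "p \<in> balanced_words m n \<Longrightarrow> height m n p = 0"
  by (simp add: balanced_words_def height_def)

lemma rational_dyck_paths_iff:
  "p \<in> rational_dyck_paths m n \<longleftrightarrow>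
     p \<in> balanced_words m n \<and> (\<forall>k \<le> length p. height m n (take k p) \<ge> 0)"
  by (auto simp: rational_dyck_paths_def balanced_words_def vertices_def vertex_def height_def)

lemma count_list_rotate: "count_list (rotate k p) s = count_list p s"
proof -
  have "count_list (rotate1 q) s = count_list q s" for q
    by (cases q) auto
  then show ?thesis by (induction k) auto
qed

lemma rotate_mem_balanced_words:
  "rotate k p \<in> balanced_words m n \<longleftrightarrow> p \<in> balanced_words m n"
  by (simp add: balanced_words_def count_list_rotate)

text \<open>A prefix of the shift is a stretch of p read cyclically from index k. As p has total
  height 0, the height of this prefix is the height of p where the stretch ends minus the height at
  k, so nonnegativity says that k is a minimum.\<close>

lemma rotate_mem_rational_dyck_paths:
  assumes p: "p \<in> balanced_words m n" and k: "k < length p"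
  shows "rotate k p \<in> rational_dyck_paths m n \<longleftrightarrow>
    (\<forall>i \<le> length p. height m n (take k p) \<le> height m n (take i p))"
proof -
  let ?h = "\<lambda>i. height m n (take i p)"
  have rot: "rotate k p = drop k p @ take k p"
    using k by (simp add: rotate_drop_take)
  have drop: "height m n (drop k p) = - ?h k"
    using height_append[of m n "take k p" "drop k p"] height_balanced_word[OF p] by simp
  have low: "height m n (take j (rotate k p)) = ?h (k + j) - ?h k" if "j \<le> length p - k" for j
    using that height_append[of m n "take k p" "take j (drop k p)"]
    by (simp add: rot flip: take_add)
  \<comment> \<open>Past the wrap, all of \<open>drop k p\<close> has been read and contributes
    \<open>- ?h k\<close>.\<close>
  have high: "height m n (take j (rotate k p)) = ?h (j - (length p - k)) - ?h k"
    if "j \<ge> length p - k" "j \<le> length p" for j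
  proof -
    have "min (j + k - length p) k = j + k - length p" using that by linarith
    then show ?thesis
      using that k drop by (simp add: rot height_append)
  qed
  have "(\<forall>j \<le> length p. height m n (take j (rotate k p)) \<ge> 0) \<longleftrightarrow>
      (\<forall>i \<le> length p. ?h k \<le> ?h i)"
  proof (intro iffI allI impI)
    fix i assume *: "\<forall>j \<le> length p. height m n (take j (rotate k p)) \<ge> 0" and "i \<le> length p"
    show "?h k \<le> ?h i"
    \<comment> \<open>Indices from k on are reached before the wrap, smaller ones after it.\<close>
    proof (cases "k \<le> i")
      case True
      then show ?thesis
        using *[rule_format, of "i - k"] low[of "i - k"] \<open>i \<le> length p\<close> by simp
    next
      case False
      then show ?thesis
        using *[rule_format, of "i + (length p - k)"] high[of "i + (length p - k)"] k by simp
    qed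
  next
    fix j assume *: "\<forall>i \<le> length p. ?h k \<le> ?h i" and j: "j \<le> length p"
    show "height m n (take j (rotate k p)) \<ge> 0"
    proof (cases "j \<le> length p - k")
      case True
      then show ?thesis using *[rule_format, of "k + j"] low[of j] k by simp
    next
      case False
      then show ?thesis using *[rule_format, of "j - (length p - k)"] high[of j] j by simp
    qed
  qed
  then show ?thesis
    using p by (simp add: rational_dyck_paths_iff rotate_mem_balanced_words)
qed

lemma dyck_shifts_nonempty:
  assumes "p \<in> balanced_words m n" "p \<noteq> []"
  shows "dyck_shifts m n p \<noteq> {}"
proof -
  let ?h = "\<lambda>i. height m n (take i p)"
  \<comment> \<open>Only indices below \<open>length p\<close> count as shifts; the minimum over
    them also bounds the endpoint, which has the height of the origin.\<close>
  obtain k where k: "k < length p" "\<forall>i < length p. ?h k \<le> ?h i"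
    using ex_min_if_finite[of "?h ` {..<length p}"] assms(2)
    by (auto simp: not_less)
  have "?h (length p) = ?h 0"
    using height_balanced_word[OF assms(1)] by simp
  with k have "\<forall>i \<le> length p. ?h k \<le> ?h i"
    by (metis le_neq_implies_less less_nat_zero_code not_gr_zero)
  then show ?thesis
    using k(1) assms(1) by (auto simp: dyck_shifts_def rotate_mem_rational_dyck_paths)
qed

text \<open>Rotating a word by one step only relabels its shifts: index k of
  \<open>rotate1 q\<close> is index k + 1 of q modulo the length.\<close>

lemma card_dyck_shifts_rotate: "card (dyck_shifts m n (rotate j p)) = card (dyck_shifts m n p)"
proof -
  have "card (dyck_shifts m n (rotate1 q)) = card (dyck_shifts m n q)" for q
  proof (cases "q = []")
    case False
    let ?N = "length q"
    have pred: "(Suc k mod ?N + (?N - 1)) mod ?N = k" if "k < ?N" for k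
    proof -
      have "Suc k + (?N - 1) = k + ?N" using that by simp
      then show ?thesis using that by (simp only: mod_add_left_eq) simp
    qed
    have "bij_betw (\<lambda>k. Suc k mod ?N) (dyck_shifts m n (rotate1 q)) (dyck_shifts m n q)"
    \<comment> \<open>Adding \<open>?N - 1\<close> modulo \<open>?N\<close> is the cyclic
      predecessor, free of truncated subtraction at 0.\<close>
    proof (rule bij_betw_byWitness[where f' = "\<lambda>k. (k + (?N - 1)) mod ?N"])
      show "\<forall>k \<in> dyck_shifts m n (rotate1 q). (Suc k mod ?N + (?N - 1)) mod ?N = k"
        using pred by (simp add: dyck_shifts_def)
      show "\<forall>k \<in> dyck_shifts m n q. Suc ((k + (?N - 1)) mod ?N) mod ?N = k"
        using False by (auto simp: dyck_shifts_def mod_Suc_eq)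
      have rot: "rotate k (rotate1 q) = rotate (Suc k mod ?N) q" for k
        by (metis rotate_Suc rotate1_rotate_swap rotate_conv_mod)
      show "(\<lambda>k. Suc k mod ?N) ` dyck_shifts m n (rotate1 q) \<subseteq> dyck_shifts m n q"
        using False by (auto simp: dyck_shifts_def rot)
      show "(\<lambda>k. (k + (?N - 1)) mod ?N) ` dyck_shifts m n q \<subseteq> dyck_shifts m n (rotate1 q)"
        using False by (auto simp: dyck_shifts_def rot mod_Suc_eq)
    qed
    then show ?thesis by (rule bij_betw_same_card)
  qed simp
  then show ?thesis by (induction j) auto
qed

lemma card_anchors_eq_card_dyck_shifts:
  assumes p: "p \<in> rational_dyck_paths m n"
  shows "card (anchors m n p) = card (dyck_shifts m n p)"
proof -
  let ?h = "\<lambda>i. height m n (take i p)" and ?N = "length p"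
  have bal: "p \<in> balanced_words m n" and nonneg: "\<And>k. k \<le> ?N \<Longrightarrow> ?h k \<ge> 0"
    using p by (auto simp: rational_dyck_paths_iff)
  have ends: "?h 0 = 0" "?h ?N = 0"
    using height_balanced_word[OF bal] by auto
  have len: "count_list (take k p) Up + count_list (take k p) Right = k" if "k \<le> ?N" for k
    using length_step_list[of "take k p"] that by simp
  \<comment> \<open>The coordinates of a vertex sum to its index, so anchors can be counted by
    index.\<close>
  have inj: "inj_on (vertex p) {0..?N}"
    using len by (auto simp: inj_on_def vertex_def) metis
  have "vertex p k = (0, 0) \<longleftrightarrow> k = 0" if "k \<le> ?N" for k
    using len[OF that] by (auto simp: vertex_def)
  then have "anchors m n p = vertex p ` {k \<in> {0<..?N}. ?h k = 0}"
    by (force simp: anchors_def vertices_def vertex_def height_def)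
  then have "card (anchors m n p) = card {k \<in> {0<..?N}. ?h k = 0}"
    by (simp add: card_image inj_on_subset[OF inj] subset_eq)
  \<comment> \<open>Anchors include the endpoint and omit the origin, shifts do the opposite; both
    points have height 0, so index \<open>?N\<close> is traded for 0.\<close>
  also have "\<dots> = card {k \<in> {..<?N}. ?h k = 0}"
    by (rule bij_betw_same_card[where f = "\<lambda>k. if k = ?N then 0 else k"],
        rule bij_betw_byWitness[where f' = "\<lambda>k. if k = 0 then ?N else k"])
      (use ends in auto)
  also have "{k \<in> {..<?N}. ?h k = 0} = dyck_shifts m n p"
  proof -
    \<comment> \<open>On a Dyck path the minimal height is 0, attained at the origin.\<close>
    have "?h k = 0 \<longleftrightarrow> (\<forall>i \<le> ?N. ?h k \<le> ?h i)" if "k < ?N" for k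
      using nonneg ends(1) that by (metis le0 less_imp_le order_antisym)
    then show ?thesis
      using bal by (auto simp: dyck_shifts_def rotate_mem_rational_dyck_paths)
  qed
  finally show ?thesis .
qed

text \<open>Double counting of the sum of \<open>f (rotate k p)\<close> over all k < m + n and all
  balanced p: for fixed k, rotation permutes the balanced words and gives \<open>sum f ?B\<close>;
  for fixed p the sum is 1.\<close>

lemma sum_inverse_card_anchors:
  assumes "m + n > 0"
  shows "real (m + n) * (\<Sum>p \<in> rational_dyck_paths m n. 1 / real (card (anchors m n p)))
       = real ((m + n) choose n)"
proof -
  let ?B = "balanced_words m n" and ?D = "rational_dyck_paths m n"
  let ?r = "\<lambda>p. card (dyck_shifts m n p)"
  \<comment> \<open>Extended by 0 from Dyck paths to balanced words, a set closed under
    rotation.\<close>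
  define f where "f p = (if p \<in> ?D then 1 / real (?r p) else 0)" for p
  have rotate_bij: "bij_betw (rotate k) ?B ?B" for k
  proof (rule bij_betw_imageI)
    show inj: "inj_on (rotate k) ?B"
      by (rule inj_on_subset[of _ UNIV]) (simp_all add: rotate_def inj_fn inj_rotate1)
    show "rotate k ` ?B = ?B"
      by (rule endo_inj_surj[OF finite_balanced_words _ inj])
        (auto simp: rotate_mem_balanced_words)
  qed
  have "(\<Sum>p \<in> ?D. 1 / real (card (anchors m n p))) = (\<Sum>p \<in> ?D. 1 / real (?r p))"
    by (simp add: card_anchors_eq_card_dyck_shifts)
  also have "\<dots> = sum f ?B"
    unfolding f_def
    by (rule sum.mono_neutral_cong_left)
       (auto simp: finite_balanced_words rational_dyck_paths_iff)
  finally have "real (m + n) * (\<Sum>p \<in> ?D. 1 / real (card (anchors m n p)))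
      = (\<Sum>k<m + n. sum f ?B)"
    by simp
  also have "\<dots> = (\<Sum>k<m + n. \<Sum>p \<in> ?B. f (rotate k p))"
    by (intro sum.cong refl sum.reindex_bij_betw[OF rotate_bij, symmetric])
  also have "\<dots> = (\<Sum>p \<in> ?B. \<Sum>k<m + n. f (rotate k p))"
    by (rule sum.swap)
  also have "\<dots> = (\<Sum>p \<in> ?B. 1)"
  proof (rule sum.cong[OF refl])
    fix p assume p: "p \<in> ?B"
    then have len: "length p = m + n" by (rule length_balanced_words)
    have fin: "finite (dyck_shifts m n p)" by (simp add: dyck_shifts_def)
    \<comment> \<open>All shifts of p share the same \<open>?r\<close>, so each of the
      \<open>?r p\<close> nonzero terms is \<open>1 / real (?r p)\<close>.\<close>
    have "(\<Sum>k<m + n. f (rotate k p)) = (\<Sum>k \<in> dyck_shifts m n p. 1 / real (?r p))"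
      unfolding f_def card_dyck_shifts_rotate
      by (rule sum.mono_neutral_cong_right) (auto simp: dyck_shifts_def len)
    \<comment> \<open>Since m + n > 0, p is nonempty and has a good shift, which excludes division
      by 0.\<close>
    also have "\<dots> = 1"
      using dyck_shifts_nonempty[OF p] fin assms len by (cases "p = []") auto
    finally show "(\<Sum>k<m + n. f (rotate k p)) = 1" .
  qed
  finally show ?thesis by (simp add: card_balanced_words)
qed

theorem theorem1:
  fixes m n :: nat
  assumes "m > 0" and "n > 0"
  shows "(\<Sum>p \<in> rational_dyck_paths m n. real (gcd m n) / real (card (anchors m n p)))
       = real (gcd m n) / real (m + n) * real ((m + n) choose n)"
proof -
  have "(\<Sum>p \<in> rational_dyck_paths m n. real (gcd m n) / real (card (anchors m n p)))
      = real (gcd m n) * (\<Sum>p \<in> rational_dyck_paths m n. 1 / real (card (anchors m n p)))"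
    by (simp add: sum_distrib_left)
  then show ?thesis
    using sum_inverse_card_anchors[of m n] assms by (simp add: field_simps)
qed

end
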